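(* Let $\mathcal{C}$ be a small category with weak pullbacks. If an internal frame $L\in\mathsf{Frm}[\mathcal{C}^{op},\mathsf{Set}]$ is (internally) stably locally compact, then all its sections $La$, $a\in\mathcal{C}$, are stably locally compact.
   Context: For an arrow $f$ of $\mathcal{C}$, $\vartheta_0 f$ is its source and $\vartheta_1 f$ its target. An internal frame in $[\mathcal{C}^{op},\mathsf{Set}]$ is (described as) a functor $L$ from $\mathcal{C}^{op}$ to frames such that each $Lf\colon La\to Lb$ ($f\colon b\to a$) has a left adjoint $\Sigma_f\colon Lb\to La$ satisfying the Beck-Chevalley condition $Ls\circ\Sigma_r=\Sigma_q\circ Lp$ for every weak pullback square $rp=sq$ in $\mathcal{C}$, and Frobenius reciprocity $\Sigma_f(Lf(u)\wedge v)=u\wedge\Sigma_f v$. For a lattice $K$, $\mathrm{idl}\,K$ is the poset of ideals of $K$ (subsets containing $0$, downward closed, closed under binary joins) ordered by inclusion; for a map $h\colon K\to K'$ and $I\subseteq K$, $h[I]$ denotes the ideal generated by the direct image of $I$. The way-below relation on a frame: $x\ll y$ iff for every directed $S$ with $y\le\bigvee S$ there is $s\in S$ with $x\le s$. A frame $K$ is locally compact if it is a continuous lattice; equivalently, the supremum map $\bigvee\colon\mathrm{idl}\,K\to K$ has a left adjoint $\lambda$ (namely $\lambda(x)=\{y\mid y\ll x\}$). A locally compact frame is stably locally compact if its way-below relation is stable under binary infima, i.e. $\lambda$ preserves binary infima: $\lambda(u\wedge w)=\lambda(u)\cap\lambda(w)$. The internal ideal object of an internal frame $L$ is the presheaf of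 posets $\mathrm{idl}_{\hat{\mathcal{C}}}L$ with $$\mathrm{idl}_{\hat{\mathcal{C}}}L(a)=\Big\{(I_f)_{\vartheta_1 f=a}\ \Big|\ I_f\in\mathrm{idl}(L(\vartheta_0 f)),\ Lg[I_f]\subseteq I_{fg}\text{ whenever }\vartheta_1 g=\vartheta_0 f\Big\},$$ ordered by componentwise inclusion (finite infima are componentwise intersections), with transition along $r\colon b\to a$ given by $(I_f)_{\vartheta_1 f=a}\mapsto(I_{rh})_{\vartheta_1 h=b}$. The internal supremum map $S\colon\mathrm{idl}_{\hat{\mathcal{C}}}L\to L$ is $S_a((I_f)_{\vartheta_1 f=a})=\bigvee\bigcup_{\vartheta_1 f=a}\Sigma_f[I_f]$. The internal frame $L$ is (internally) locally compact if there is a natural transformation of presheaves of posets $\Lambda\colon L\to\mathrm{idl}_{\hat{\mathcal{C}}}L$ left adjoint to $S$ (i.e. $\Lambda_a\dashv S_a$ for all $a$); it is (internally) stably locally compact if moreover $\Lambda$ preserves binary infima, i.e. each $\Lambda_a$ does. *)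

theory Defs
  imports "HOL-Algebra.Galois_Connection"
begin

section \<open>Small categories and weak pullbacks\<close>

text \<open>\<open>f \<cdot> g\<close> is the composite ``\<open>f\<close> after \<open>g\<close>''; it is meaningful if \<open>Dom f = Cod g\<close>.\<close>

record ('o, 'm) cat =
  Obj :: "'o set"
  Arr :: "'m set"
  Dom :: "'m \<Rightarrow> 'o"
  Cod :: "'m \<Rightarrow> 'o"
  Ident :: "'o \<Rightarrow> 'm"
  Comp :: "'m \<Rightarrow> 'm \<Rightarrow> 'm" (infixl \<open>\<cdot>\<index>\<close> 70)

locale category =
  fixes C :: "('o, 'm) cat" (structure)
  assumes Dom_Obj: "f \<in> Arr C \<Longrightarrow> Dom C f \<in> Obj C"
    and Cod_Obj: "f \<in> Arr C \<Longrightarrow> Cod C f \<in> Obj C"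
    and Ident_Arr: "a \<in> Obj C \<Longrightarrow> Ident C a \<in> Arr C"
    and Dom_Ident: "a \<in> Obj C \<Longrightarrow> Dom C (Ident C a) = a"
    and Cod_Ident: "a \<in> Obj C \<Longrightarrow> Cod C (Ident C a) = a"
    and Comp_Arr: "\<lbrakk>f \<in> Arr C; g \<in> Arr C; Dom C f = Cod C g\<rbrakk> \<Longrightarrow> f \<cdot> g \<in> Arr C"
    and Dom_Comp: "\<lbrakk>f \<in> Arr C; g \<in> Arr C; Dom C f = Cod C g\<rbrakk> \<Longrightarrow> Dom C (f \<cdot> g) = Dom C g"
    and Cod_Comp: "\<lbrakk>f \<in> Arr C; g \<in> Arr C; Dom C f = Cod C g\<rbrakk> \<Longrightarrow> Cod C (f \<cdot> g) = Cod C f"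
    and Comp_Ident: "f \<in> Arr C \<Longrightarrow> f \<cdot> Ident C (Dom C f) = f"
    and Ident_Comp: "f \<in> Arr C \<Longrightarrow> Ident C (Cod C f) \<cdot> f = f"
    and Comp_assoc: "\<lbrakk>f \<in> Arr C; g \<in> Arr C; h \<in> Arr C; Dom C f = Cod C g; Dom C g = Cod C h\<rbrakk>
      \<Longrightarrow> (f \<cdot> g) \<cdot> h = f \<cdot> (g \<cdot> h)"

definition arrows_into :: "('o, 'm) cat \<Rightarrow> 'o \<Rightarrow> 'm set" where
  "arrows_into C a = {f \<in> Arr C. Cod C f = a}"

definition commuting_square :: "('o, 'm) cat \<Rightarrow> 'm \<Rightarrow> 'm \<Rightarrow> 'm \<Rightarrow> 'm \<Rightarrow> bool" where
  "commuting_square C r p s q \<longleftrightarrow>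
     r \<in> Arr C \<and> p \<in> Arr C \<and> s \<in> Arr C \<and> q \<in> Arr C \<and>
     Cod C r = Cod C s \<and> Dom C p = Dom C q \<and> Cod C p = Dom C r \<and> Cod C q = Dom C s \<and>
     r \<cdot>\<^bsub>C\<^esub> p = s \<cdot>\<^bsub>C\<^esub> q"

text \<open>Weak: the mediating arrow \<open>h\<close> need not be unique.\<close>

definition weak_pullback_square :: "('o, 'm) cat \<Rightarrow> 'm \<Rightarrow> 'm \<Rightarrow> 'm \<Rightarrow> 'm \<Rightarrow> bool" where
  "weak_pullback_square C r p s q \<longleftrightarrow>
     commuting_square C r p s q \<and>
     (\<forall>p' q'. commuting_square C r p' s q' \<longrightarrow>
        (\<exists>h\<in>Arr C. Dom C h = Dom C p' \<and> Cod C h = Dom C p \<and> p \<cdot>\<^bsub>C\<^esub> h = p' \<and> q \<cdot>\<^bsub>C\<^esub> h = q'))"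

definition has_weak_pullbacks :: "('o, 'm) cat \<Rightarrow> bool" where
  "has_weak_pullbacks C \<longleftrightarrow>
     (\<forall>r\<in>Arr C. \<forall>s\<in>Arr C. Cod C r = Cod C s \<longrightarrow> (\<exists>p q. weak_pullback_square C r p s q))"


section \<open>Frames, ideals and stable local compactness\<close>

locale frame = complete_lattice K for K (structure) +
  assumes inf_Sup_distrib: "\<lbrakk>x \<in> carrier K; A \<subseteq> carrier K\<rbrakk> \<Longrightarrow> x \<sqinter> \<Squnion>A = \<Squnion>((\<lambda>y. x \<sqinter> y) ` A)"

definition frame_hom :: "'x gorder \<Rightarrow> 'y gorder \<Rightarrow> ('x \<Rightarrow> 'y) \<Rightarrow> bool" where
  "frame_hom K K' h \<longleftrightarrow>
     h \<in> carrier K \<rightarrow> carrier K' \<and> sup_pres K K' h \<and> meet_pres K K' h \<and> h \<top>\<^bsub>K\<^esub> = \<top>\<^bsub>K'\<^esub>"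

abbreviation adjoint_pair :: "'x gorder \<Rightarrow> 'y gorder \<Rightarrow> ('x \<Rightarrow> 'y) \<Rightarrow> ('y \<Rightarrow> 'x) \<Rightarrow> bool" where
  "adjoint_pair A B l u \<equiv>
     galois_connection \<lparr>orderA = A, orderB = B, lower = l, upper = u\<rparr>"

definition ideals :: "'x gorder \<Rightarrow> 'x set set" where
  "ideals K = {I. I \<subseteq> carrier K \<and> \<bottom>\<^bsub>K\<^esub> \<in> I \<and>
     (\<forall>x\<in>I. \<forall>y\<in>carrier K. y \<sqsubseteq>\<^bsub>K\<^esub> x \<longrightarrow> y \<in> I) \<and> (\<forall>x\<in>I. \<forall>y\<in>I. x \<squnion>\<^bsub>K\<^esub> y \<in> I)}"

definition generated_ideal :: "'x gorder \<Rightarrow> 'x set \<Rightarrow> 'x set" where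
  "generated_ideal K X = \<Inter>{I \<in> ideals K. X \<subseteq> I}"

text \<open>\<open>image_ideal K' h I\<close> is \<open>h[I]\<close>, where \<open>K'\<close> is the codomain of \<open>h\<close>.\<close>

definition image_ideal :: "'y gorder \<Rightarrow> ('x \<Rightarrow> 'y) \<Rightarrow> 'x set \<Rightarrow> 'y set" where
  "image_ideal K' h I = generated_ideal K' (h ` I)"

definition directed_in :: "'x gorder \<Rightarrow> 'x set \<Rightarrow> bool" where
  "directed_in K S \<longleftrightarrow> S \<subseteq> carrier K \<and> S \<noteq> {} \<and>
     (\<forall>x\<in>S. \<forall>y\<in>S. \<exists>z\<in>S. x \<sqsubseteq>\<^bsub>K\<^esub> z \<and> y \<sqsubseteq>\<^bsub>K\<^esub> z)"

definition way_below :: "'x gorder \<Rightarrow> 'x \<Rightarrow> 'x \<Rightarrow> bool" where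
  "way_below K x y \<longleftrightarrow> x \<in> carrier K \<and> y \<in> carrier K \<and>
     (\<forall>S. directed_in K S \<longrightarrow> y \<sqsubseteq>\<^bsub>K\<^esub> \<Squnion>\<^bsub>K\<^esub>S \<longrightarrow> (\<exists>s\<in>S. x \<sqsubseteq>\<^bsub>K\<^esub> s))"

definition locally_compact_frame :: "'x gorder \<Rightarrow> bool" where
  "locally_compact_frame K \<longleftrightarrow> frame K \<and> (\<forall>x\<in>carrier K. x = \<Squnion>\<^bsub>K\<^esub>{y. way_below K y x})"

definition stably_locally_compact_frame :: "'x gorder \<Rightarrow> bool" where
  "stably_locally_compact_frame K \<longleftrightarrow> locally_compact_frame K \<and>
     (\<forall>u\<in>carrier K. \<forall>w\<in>carrier K.
        {y. way_below K y (u \<sqinter>\<^bsub>K\<^esub> w)} = {y. way_below K y u} \<inter> {y. way_below K y w})"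


section \<open>Internal frames in presheaf categories\<close>

text \<open>
  The sections \<open>L a\<close> are frames on carrier subsets of a common type. For \<open>f : b \<rightarrow> a\<close>, \<open>res f\<close> is
  the transition map \<open>L f : L a \<rightarrow> L b\<close> and \<open>Sig f\<close> its left adjoint, which is uniquely determined
  on \<open>carrier (L b)\<close>. Only values on carriers are constrained.
\<close>

locale frame_presheaf = category C for C :: "('o, 'm) cat" (structure) +
  fixes L :: "'o \<Rightarrow> 'x gorder" and res :: "'m \<Rightarrow> 'x \<Rightarrow> 'x"
  assumes section_frame: "a \<in> Obj C \<Longrightarrow> frame (L a)"
    and res_hom: "f \<in> Arr C \<Longrightarrow> frame_hom (L (Cod C f)) (L (Dom C f)) (res f)"
    and res_Ident: "\<lbrakk>a \<in> Obj C; u \<in> carrier (L a)\<rbrakk> \<Longrightarrow> res (Ident C a) u = u"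
    and res_Comp: "\<lbrakk>f \<in> Arr C; g \<in> Arr C; Dom C f = Cod C g; u \<in> carrier (L (Cod C f))\<rbrakk>
      \<Longrightarrow> res (f \<cdot> g) u = res g (res f u)"

locale internal_frame = frame_presheaf C L res
  for C :: "('o, 'm) cat" (structure) and L :: "'o \<Rightarrow> 'x gorder" and res :: "'m \<Rightarrow> 'x \<Rightarrow> 'x" +
  fixes Sig :: "'m \<Rightarrow> 'x \<Rightarrow> 'x"
  assumes Sig_adjoint: "f \<in> Arr C \<Longrightarrow> adjoint_pair (L (Dom C f)) (L (Cod C f)) (Sig f) (res f)"
    and Beck_Chevalley: "\<lbrakk>weak_pullback_square C r p s q; v \<in> carrier (L (Dom C r))\<rbrakk>
      \<Longrightarrow> res s (Sig r v) = Sig q (res p v)"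
    and Frobenius: "\<lbrakk>f \<in> Arr C; u \<in> carrier (L (Cod C f)); v \<in> carrier (L (Dom C f))\<rbrakk>
      \<Longrightarrow> Sig f (res f u \<sqinter>\<^bsub>L (Dom C f)\<^esub> v) = u \<sqinter>\<^bsub>L (Cod C f)\<^esub> Sig f v"

text \<open>
  A family \<open>(I\<^sub>f)\<close> indexed by the arrows into \<open>a\<close> is an extensional function (\<open>undefined\<close> on all
  other arrows), so that equality of such functions is equality of families.
\<close>

definition internal_idl ::
  "('o, 'm) cat \<Rightarrow> ('o \<Rightarrow> 'x gorder) \<Rightarrow> ('m \<Rightarrow> 'x \<Rightarrow> 'x) \<Rightarrow> 'o \<Rightarrow> ('m \<Rightarrow> 'x set) gorder" where
  "internal_idl C L res a =
     \<lparr>carrier = {I \<in> \<Pi>\<^sub>E f\<in>arrows_into C a. ideals (L (Dom C f)).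
        \<forall>f\<in>arrows_into C a. \<forall>g\<in>Arr C. Cod C g = Dom C f \<longrightarrow>
          image_ideal (L (Dom C g)) (res g) (I f) \<subseteq> I (f \<cdot>\<^bsub>C\<^esub> g)},
      eq = (=),
      le = (\<lambda>I J. \<forall>f\<in>arrows_into C a. I f \<subseteq> J f)\<rparr>"

definition internal_idl_res :: "('o, 'm) cat \<Rightarrow> 'm \<Rightarrow> ('m \<Rightarrow> 'x set) \<Rightarrow> ('m \<Rightarrow> 'x set)" where
  "internal_idl_res C r I = (\<lambda>h\<in>arrows_into C (Dom C r). I (r \<cdot>\<^bsub>C\<^esub> h))"

definition internal_Sup ::
  "('o, 'm) cat \<Rightarrow> ('o \<Rightarrow> 'x gorder) \<Rightarrow> ('m \<Rightarrow> 'x \<Rightarrow> 'x) \<Rightarrow> 'o \<Rightarrow> ('m \<Rightarrow> 'x set) \<Rightarrow> 'x" where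
  "internal_Sup C L Sig a I = \<Squnion>\<^bsub>L a\<^esub>(\<Union>f\<in>arrows_into C a. image_ideal (L a) (Sig f) (I f))"

text \<open>\<open>Lam\<close> is a natural transformation of presheaves of posets which is left adjoint to the
  internal supremum map.\<close>

definition left_adjoint_to_internal_Sup ::
  "('o, 'm) cat \<Rightarrow> ('o \<Rightarrow> 'x gorder) \<Rightarrow> ('m \<Rightarrow> 'x \<Rightarrow> 'x) \<Rightarrow> ('m \<Rightarrow> 'x \<Rightarrow> 'x)
    \<Rightarrow> ('o \<Rightarrow> 'x \<Rightarrow> 'm \<Rightarrow> 'x set) \<Rightarrow> bool" where
  "left_adjoint_to_internal_Sup C L res Sig Lam \<longleftrightarrow>
     (\<forall>a\<in>Obj C. Lam a \<in> carrier (L a) \<rightarrow> carrier (internal_idl C L res a) \<and>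
        isotone (L a) (internal_idl C L res a) (Lam a)) \<and>
     (\<forall>r\<in>Arr C. \<forall>u\<in>carrier (L (Cod C r)).
        Lam (Dom C r) (res r u) = internal_idl_res C r (Lam (Cod C r) u)) \<and>
     (\<forall>a\<in>Obj C. adjoint_pair (L a) (internal_idl C L res a) (Lam a) (internal_Sup C L Sig a))"

definition internally_locally_compact ::
  "('o, 'm) cat \<Rightarrow> ('o \<Rightarrow> 'x gorder) \<Rightarrow> ('m \<Rightarrow> 'x \<Rightarrow> 'x) \<Rightarrow> ('m \<Rightarrow> 'x \<Rightarrow> 'x) \<Rightarrow> bool" where
  "internally_locally_compact C L res Sig \<longleftrightarrow>
     (\<exists>Lam. left_adjoint_to_internal_Sup C L res Sig Lam)"

text \<open>Binary infima in \<^const>\<open>internal_idl\<close> are componentwise intersections.\<close>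

definition internally_stably_locally_compact ::
  "('o, 'm) cat \<Rightarrow> ('o \<Rightarrow> 'x gorder) \<Rightarrow> ('m \<Rightarrow> 'x \<Rightarrow> 'x) \<Rightarrow> ('m \<Rightarrow> 'x \<Rightarrow> 'x) \<Rightarrow> bool" where
  "internally_stably_locally_compact C L res Sig \<longleftrightarrow>
     (\<exists>Lam. left_adjoint_to_internal_Sup C L res Sig Lam \<and>
       (\<forall>a\<in>Obj C. \<forall>u\<in>carrier (L a). \<forall>w\<in>carrier (L a).
          Lam a (u \<sqinter>\<^bsub>L a\<^esub> w) = (\<lambda>f\<in>arrows_into C a. Lam a u f \<inter> Lam a w f)))"

end

theory Submission
  imports Defs
begin

text \<open>
  Write \<open>\<Lambda>\<close> for the internal left adjoint. The identity component of \<open>\<Lambda>\<^sub>a u\<close> consists of elements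
  way below \<open>u\<close>: an ideal \<open>J\<close> of \<open>L a\<close> with \<open>u \<le> \<Squnion>J\<close> extends, by restricting it along all arrows
  into \<open>a\<close>, to an internal ideal whose internal supremum is still above \<open>u\<close>, so adjointness bounds
  \<open>\<Lambda>\<^sub>a u\<close> by this internal ideal, whose identity component is \<open>J\<close> again. Naturality identifies the
  component of \<open>\<Lambda>\<^sub>a u\<close> at \<open>f : b \<rightarrow> a\<close> with the identity component of \<open>\<Lambda>\<^sub>b (L f u)\<close>, so every
  component of \<open>\<Lambda>\<^sub>a u\<close> consists of elements way below a restriction of \<open>u\<close>.

  The left adjoint \<open>\<Sigma>\<^sub>f\<close> of the frame homomorphism \<open>L f\<close> takes \<open>z \<lless> L f u\<close> to \<open>\<Sigma>\<^sub>f z \<lless> u\<close>. Hence all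
  pushforwards \<open>\<Sigma>\<^sub>f z\<close> with \<open>z\<close> in the component of \<open>\<Lambda>\<^sub>a u\<close> at \<open>f\<close> are way below \<open>u\<close>, and the unit of
  \<open>\<Lambda>\<^sub>a \<stileturn> S\<^sub>a\<close> says that they cover \<open>u\<close>. This gives local compactness; moreover, everything way
  below \<open>u\<close> lies in the ideal generated by these pushforwards.

  For stability, this last fact and distributivity reduce the claim to the meet of a pushforward
  \<open>\<Sigma>\<^sub>f z\<close> for \<open>u\<close> and a pushforward \<open>\<Sigma>\<^sub>g t\<close> for \<open>w\<close>. With \<open>f p = g q\<close> a weak pullback square,
  Beck-Chevalley and Frobenius give \<open>\<Sigma>\<^sub>f z \<sqinter> \<Sigma>\<^sub>g t = \<Sigma>\<^sub>f\<^sub>p (L p z \<sqinter> L q t)\<close>. Both \<open>L p z\<close> and \<open>L q t\<close> belong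
  to components at the same arrow \<open>f p\<close>, of \<open>\<Lambda>\<^sub>a u\<close> and \<open>\<Lambda>\<^sub>a w\<close> respectively. So their meet belongs
  to the component of \<open>\<Lambda>\<^sub>a (u \<sqinter> w)\<close>, and \<open>\<Sigma>\<^sub>f z \<sqinter> \<Sigma>\<^sub>g t\<close> is a pushforward for \<open>u \<sqinter> w\<close>.
\<close>

section \<open>Ideals and the way-below relation in a frame\<close>

lemma idealsI:
  assumes "I \<subseteq> carrier K" "\<bottom>\<^bsub>K\<^esub> \<in> I"
    and "\<And>x y. \<lbrakk>x \<in> I; y \<in> carrier K; y \<sqsubseteq>\<^bsub>K\<^esub> x\<rbrakk> \<Longrightarrow> y \<in> I"
    and "\<And>x y. \<lbrakk>x \<in> I; y \<in> I\<rbrakk> \<Longrightarrow> x \<squnion>\<^bsub>K\<^esub> y \<in> I"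
  shows "I \<in> ideals K"
  using assms unfolding ideals_def by blast

lemma ideals_subset: "I \<in> ideals K \<Longrightarrow> I \<subseteq> carrier K"
  and ideals_bottom: "I \<in> ideals K \<Longrightarrow> \<bottom>\<^bsub>K\<^esub> \<in> I"
  and ideals_down: "\<lbrakk>I \<in> ideals K; x \<in> I; y \<in> carrier K; y \<sqsubseteq>\<^bsub>K\<^esub> x\<rbrakk> \<Longrightarrow> y \<in> I"
  and ideals_join: "\<lbrakk>I \<in> ideals K; x \<in> I; y \<in> I\<rbrakk> \<Longrightarrow> x \<squnion>\<^bsub>K\<^esub> y \<in> I"
  unfolding ideals_def by blast+

lemma generated_ideal_incl: "x \<in> X \<Longrightarrow> x \<in> generated_ideal K X"
  unfolding generated_ideal_def by blast

lemma generated_ideal_least: "\<lbrakk>I \<in> ideals K; X \<subseteq> I\<rbrakk> \<Longrightarrow> generated_ideal K X \<subseteq> I"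
  unfolding generated_ideal_def by blast

lemma generated_ideal_ideal: "I \<in> ideals K \<Longrightarrow> generated_ideal K I = I"
  by (rule equalityI) (auto intro: generated_ideal_incl subsetD[OF generated_ideal_least])

text \<open>
  \<^const>\<open>ideals\<close> and \<^const>\<open>way_below\<close> are typed over orders without extra record fields, whereas
  \<^locale>\<open>frame\<close> allows such fields; hence the fixed type.
\<close>

locale plain_frame = frame K for K :: "'x gorder" (structure)
begin

lemma carrier_ideal: "carrier K \<in> ideals K"
  by (rule idealsI) auto

lemma generated_ideal_in_ideals:
  assumes "X \<subseteq> carrier K"
  shows "generated_ideal K X \<in> ideals K"
proof (rule idealsI)
  show "generated_ideal K X \<subseteq> carrier K"
    by (rule generated_ideal_least[OF carrier_ideal assms])
qed (auto simp: generated_ideal_def intro: ideals_bottom ideals_down ideals_join)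

lemma principal_ideal:
  assumes "c \<in> carrier K"
  shows "{x \<in> carrier K. x \<sqsubseteq> c} \<in> ideals K"
  by (rule idealsI) (use assms in \<open>auto intro: join_le le_trans\<close>)

lemma ideal_directed:
  assumes "I \<in> ideals K"
  shows "directed_in K I"
  unfolding directed_in_def
proof (intro conjI ballI)
  fix x y assume "x \<in> I" "y \<in> I"
  moreover from this have "x \<in> carrier K" "y \<in> carrier K"
    using ideals_subset[OF assms] by auto
  ultimately show "\<exists>z\<in>I. x \<sqsubseteq> z \<and> y \<sqsubseteq> z"
    using ideals_join[OF assms] join_left join_right by blast
qed (use ideals_subset[OF assms] ideals_bottom[OF assms] in auto)

text \<open>
  A directed set and the ideal of all elements below one of its members have the same upper
  bounds, so ideals suffice to test the way-below relation.
\<close>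

lemma way_belowI_ideal:
  assumes x: "x \<in> carrier K" and y: "y \<in> carrier K"
    and *: "\<And>J. \<lbrakk>J \<in> ideals K; y \<sqsubseteq> \<Squnion>J\<rbrakk> \<Longrightarrow> x \<in> J"
  shows "way_below K x y"
  unfolding way_below_def
proof (intro conjI allI impI x y)
  fix S assume S: "directed_in K S" and le: "y \<sqsubseteq> \<Squnion>S"
  have SK: "S \<subseteq> carrier K" using S by (simp add: directed_in_def)
  define J where "J = {z \<in> carrier K. \<exists>s\<in>S. z \<sqsubseteq> s}"
  have JK: "J \<subseteq> carrier K" by (auto simp: J_def)
  have "J \<in> ideals K"
  proof (rule idealsI[OF JK])
    obtain s where "s \<in> S" using S by (auto simp: directed_in_def)
    then show "\<bottom> \<in> J" using SK unfolding J_def by (blast intro: bottom_closed bottom_lower)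
  next
    fix a b assume "a \<in> J" "b \<in> carrier K" "b \<sqsubseteq> a"
    then show "b \<in> J" using SK unfolding J_def by (blast intro: le_trans)
  next
    fix a b assume a: "a \<in> J" and b: "b \<in> J"
    then obtain s t where st: "s \<in> S" "t \<in> S" "a \<sqsubseteq> s" "b \<sqsubseteq> t" by (auto simp: J_def)
    then obtain r where r: "r \<in> S" "s \<sqsubseteq> r" "t \<sqsubseteq> r"
      using S unfolding directed_in_def by blast
    have car: "a \<in> carrier K" "b \<in> carrier K" "s \<in> carrier K" "t \<in> carrier K" "r \<in> carrier K"
      using a b JK st r SK by auto
    have "a \<squnion> b \<sqsubseteq> r"
      by (rule join_le) (use car st r in \<open>blast intro: le_trans\<close>)+
    then show "a \<squnion> b \<in> J" using r car by (auto simp: J_def)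
  qed
  moreover have "y \<sqsubseteq> \<Squnion>J"
  proof -
    have "S \<subseteq> J" using SK unfolding J_def by (blast intro: le_refl)
    then have "\<Squnion>S \<sqsubseteq> \<Squnion>J"
      using JK SK by (intro sup_least sup_closed) (auto intro: sup_upper)
    then show ?thesis
      using le y by (meson le_trans sup_closed SK JK)
  qed
  ultimately have "x \<in> J" by (rule *)
  then show "\<exists>s\<in>S. x \<sqsubseteq> s" by (auto simp: J_def)
qed

lemma way_belowD_ideal:
  assumes "way_below K x y" "J \<in> ideals K" "y \<sqsubseteq> \<Squnion>J"
  shows "x \<in> J"
proof -
  obtain s where "s \<in> J" "x \<sqsubseteq> s"
    using assms ideal_directed unfolding way_below_def by blast
  then show ?thesis
    using assms(1) ideals_down[OF assms(2)] unfolding way_below_def by blast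
qed

lemma way_below_ideal:
  assumes u: "u \<in> carrier K"
  shows "{y. way_below K y u} \<in> ideals K"
proof (rule idealsI)
  show sub: "{y. way_below K y u} \<subseteq> carrier K" by (auto simp: way_below_def)
  show "\<bottom> \<in> {y. way_below K y u}"
    using u by (auto intro: way_belowI_ideal ideals_bottom)
  show "y \<in> {y. way_below K y u}"
    if "x \<in> {y. way_below K y u}" "y \<in> carrier K" "y \<sqsubseteq> x" for x y
    using that u by (auto intro: way_belowI_ideal ideals_down way_belowD_ideal)
  show "x \<squnion> y \<in> {y. way_below K y u}"
    if "x \<in> {y. way_below K y u}" "y \<in> {y. way_below K y u}" for x y
  proof -
    have "x \<squnion> y \<in> carrier K" using that sub by (intro join_closed) blast+
    then have "way_below K (x \<squnion> y) u"
    proof (rule way_belowI_ideal[OF _ u])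
      fix J assume J: "J \<in> ideals K" "u \<sqsubseteq> \<Squnion>J"
      then show "x \<squnion> y \<in> J"
        using that by (intro ideals_join[OF J(1)] way_belowD_ideal[OF _ J]) auto
    qed
    then show ?thesis by simp
  qed
qed

lemma way_below_imp_le:
  assumes "way_below K x y"
  shows "x \<sqsubseteq> y"
proof -
  have y: "y \<in> carrier K" using assms by (simp add: way_below_def)
  have "y \<sqsubseteq> \<Squnion>{z \<in> carrier K. z \<sqsubseteq> y}"
    using y by (intro sup_upper) auto
  then show ?thesis
    using way_belowD_ideal[OF assms principal_ideal[OF y]] by simp
qed

lemma way_below_mono:
  assumes "way_below K x y" "z \<in> carrier K" "y \<sqsubseteq> z"
  shows "way_below K x z"
proof (rule way_belowI_ideal)
  have xy: "x \<in> carrier K" "y \<in> carrier K"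
    using assms(1) by (auto simp: way_below_def)
  then show "x \<in> carrier K" by simp
  fix J assume J: "J \<in> ideals K" "z \<sqsubseteq> \<Squnion>J"
  then have "y \<sqsubseteq> \<Squnion>J"
    using assms xy ideals_subset sup_closed le_trans by metis
  then show "x \<in> J" by (rule way_belowD_ideal[OF assms(1) J(1)])
qed (fact assms)

text \<open>
  The ideal generated by a cover is a directed cover, so it captures everything way below.
\<close>

lemma way_below_Sup_generated:
  assumes "way_below K x y" "X \<subseteq> carrier K" "y \<sqsubseteq> \<Squnion>X"
  shows "x \<in> generated_ideal K X"
proof (rule way_belowD_ideal[OF assms(1) generated_ideal_in_ideals[OF assms(2)]])
  have sub: "generated_ideal K X \<subseteq> carrier K"
    using assms(2) generated_ideal_in_ideals ideals_subset by blast
  have "\<Squnion>X \<sqsubseteq> \<Squnion>(generated_ideal K X)"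
    using sub assms(2) generated_ideal_incl[of _ X K]
    by (intro sup_least sup_closed sup_upper) auto
  then show "y \<sqsubseteq> \<Squnion>(generated_ideal K X)"
    using assms sub by (meson le_trans sup_closed way_below_def)
qed

lemma meet_join_distrib:
  assumes "x \<in> carrier K" "y \<in> carrier K" "z \<in> carrier K"
  shows "x \<sqinter> (y \<squnion> z) = (x \<sqinter> y) \<squnion> (x \<sqinter> z)"
  using inf_Sup_distrib[of x "{y, z}"] assms by (simp add: join_def)

lemma ideal_meet_residual:
  assumes "I \<in> ideals K" "Y \<subseteq> carrier K"
  shows "{x \<in> carrier K. \<forall>y\<in>Y. y \<sqinter> x \<in> I} \<in> ideals K"
proof (rule idealsI)
  show "\<bottom> \<in> {x \<in> carrier K. \<forall>y\<in>Y. y \<sqinter> x \<in> I}"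
    using assms by (auto intro!: ideals_down[OF assms(1) ideals_bottom[OF assms(1)]] meet_right)
next
  fix a b assume a: "a \<in> {x \<in> carrier K. \<forall>y\<in>Y. y \<sqinter> x \<in> I}" and b: "b \<in> carrier K" "b \<sqsubseteq> a"
  have "y \<sqinter> b \<in> I" if "y \<in> Y" for y
  proof (rule ideals_down[OF assms(1)])
    have y: "y \<in> carrier K" using that assms by auto
    show "y \<sqinter> a \<in> I" using a that by simp
    show "y \<sqinter> b \<in> carrier K" using y b by simp
    show "y \<sqinter> b \<sqsubseteq> y \<sqinter> a"
      using y a b by (intro meet_le meet_left) (auto intro: le_trans meet_right)
  qed
  then show "b \<in> {x \<in> carrier K. \<forall>y\<in>Y. y \<sqinter> x \<in> I}" using b by simp
next
  fix a b
  assume "a \<in> {x \<in> carrier K. \<forall>y\<in>Y. y \<sqinter> x \<in> I}" "b \<in> {x \<in> carrier K. \<forall>y\<in>Y. y \<sqinter> x \<in> I}"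
  then show "a \<squnion> b \<in> {x \<in> carrier K. \<forall>y\<in>Y. y \<sqinter> x \<in> I}"
    using assms by (auto simp: meet_join_distrib subset_iff intro: ideals_join)
qed auto

text \<open>
  By distributivity, the elements whose meets with a given set lie in \<open>I\<close> form an ideal.
  Applying this in each argument in turn extends membership in \<open>I\<close> from meets of generators to
  meets of arbitrary elements, without decomposing these into finite joins.
\<close>

lemma meet_generated_ideals:
  assumes I: "I \<in> ideals K" and X: "X \<subseteq> carrier K" and Y: "Y \<subseteq> carrier K"
    and meets: "\<And>x y. \<lbrakk>x \<in> X; y \<in> Y\<rbrakk> \<Longrightarrow> x \<sqinter> y \<in> I"
    and a: "a \<in> generated_ideal K X" and b: "b \<in> generated_ideal K Y"
  shows "a \<sqinter> b \<in> I"
proof -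
  have "generated_ideal K X \<subseteq> {x \<in> carrier K. \<forall>y\<in>Y. y \<sqinter> x \<in> I}"
    using X meets by (intro generated_ideal_least ideal_meet_residual[OF I Y]) (auto simp: meet_comm)
  then have a': "a \<in> carrier K" "\<And>y. y \<in> Y \<Longrightarrow> a \<sqinter> y \<in> I"
    using a by (auto simp: meet_comm)
  then have "generated_ideal K Y \<subseteq> {y \<in> carrier K. \<forall>x\<in>{a}. x \<sqinter> y \<in> I}"
    using Y by (intro generated_ideal_least ideal_meet_residual[OF I]) auto
  then show ?thesis using b by auto
qed

end

lemma adjoint_pairD:
  assumes "adjoint_pair A B l u"
  shows "l \<in> carrier A \<rightarrow> carrier B" and "u \<in> carrier B \<rightarrow> carrier A"
    and "\<lbrakk>x \<in> carrier A; y \<in> carrier B\<rbrakk> \<Longrightarrow> l x \<sqsubseteq>\<^bsub>B\<^esub> y \<longleftrightarrow> x \<sqsubseteq>\<^bsub>A\<^esub> u y"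
  using galois_connection.galois_property[OF assms]
    connection.lower_closure[OF galois_connection.axioms(1)[OF assms]]
    connection.upper_closure[OF galois_connection.axioms(1)[OF assms]]
  by simp_all

lemma frame_homD:
  assumes "frame_hom K K' h"
  shows "h \<in> carrier K \<rightarrow> carrier K'" and "isotone K K' h"
    and "A \<subseteq> carrier K \<Longrightarrow> h (\<Squnion>\<^bsub>K\<^esub>A) = \<Squnion>\<^bsub>K'\<^esub>(h ` A)"
proof -
  have h: "h \<in> carrier K \<rightarrow> carrier K'" "sup_pres K K' h" "meet_pres K K' h"
    using assms by (simp_all add: frame_hom_def)
  show "h \<in> carrier K \<rightarrow> carrier K'" by (fact h)
  show "isotone K K' h" by (rule meet_pres_isotone[OF h(1,3)])
  show "h (\<Squnion>\<^bsub>K\<^esub>A) = \<Squnion>\<^bsub>K'\<^esub>(h ` A)" if "A \<subseteq> carrier K"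
    using h(2) that by (simp add: sup_pres_def)
qed

lemma ideal_vimage:
  assumes "plain_frame K" "plain_frame K'" "frame_hom K K' h" "J \<in> ideals K'"
  shows "{x \<in> carrier K. h x \<in> J} \<in> ideals K"
proof -
  interpret K: plain_frame K by fact
  interpret K': plain_frame K' by fact
  note h = frame_homD[OF assms(3)]
  show ?thesis
  proof (rule idealsI)
    have "\<bottom>\<^bsub>K\<^esub> = \<Squnion>\<^bsub>K\<^esub>{}" "\<bottom>\<^bsub>K'\<^esub> = \<Squnion>\<^bsub>K'\<^esub>{}"
      by (intro K.le_antisym K'.le_antisym; auto intro: K.sup_least K'.sup_least)+
    then have "h \<bottom>\<^bsub>K\<^esub> = \<bottom>\<^bsub>K'\<^esub>" using h(3)[of "{}"] by simp
    then show "\<bottom>\<^bsub>K\<^esub> \<in> {x \<in> carrier K. h x \<in> J}" using ideals_bottom[OF assms(4)] by simp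
  next
    fix x y assume "x \<in> {x \<in> carrier K. h x \<in> J}" "y \<in> carrier K" "y \<sqsubseteq>\<^bsub>K\<^esub> x"
    then show "y \<in> {x \<in> carrier K. h x \<in> J}"
      using ideals_down[OF assms(4)] h(1) use_iso2[OF h(2)] by blast
  next
    fix x y assume xy: "x \<in> {x \<in> carrier K. h x \<in> J}" "y \<in> {x \<in> carrier K. h x \<in> J}"
    have "h (x \<squnion>\<^bsub>K\<^esub> y) = h x \<squnion>\<^bsub>K'\<^esub> h y"
      using xy h(3)[of "{x, y}"] by (simp add: join_def)
    then show "x \<squnion>\<^bsub>K\<^esub> y \<in> {x \<in> carrier K. h x \<in> J}"
      using xy ideals_join[OF assms(4)] by simp
  qed auto
qed

text \<open>
  The preimage of an ideal under a frame homomorphism is an ideal; here it contains \<open>k ` I\<close>.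
\<close>

lemma image_ideal_image_ideal_subset:
  assumes K': "plain_frame K'" and K'': "plain_frame K''" and h: "frame_hom K' K'' h"
    and k: "k \<in> carrier K \<rightarrow> carrier K'" and I: "I \<subseteq> carrier K"
  shows "image_ideal K'' h (image_ideal K' k I) \<subseteq> image_ideal K'' (h \<circ> k) I"
proof -
  interpret K'': plain_frame K'' by fact
  have kI: "k ` I \<subseteq> carrier K'" and hkI: "(h \<circ> k) ` I \<subseteq> carrier K''"
    using k I frame_homD(1)[OF h] by auto
  have ideal: "image_ideal K'' (h \<circ> k) I \<in> ideals K''"
    unfolding image_ideal_def by (rule K''.generated_ideal_in_ideals[OF hkI])
  have "image_ideal K' k I \<subseteq> {x \<in> carrier K'. h x \<in> image_ideal K'' (h \<circ> k) I}"
    unfolding image_ideal_def[of K']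
  proof (rule generated_ideal_least[OF ideal_vimage[OF K' K'' h ideal]])
    show "k ` I \<subseteq> {x \<in> carrier K'. h x \<in> image_ideal K'' (h \<circ> k) I}"
      using kI generated_ideal_incl[of _ "(h \<circ> k) ` I" K''] by (auto simp: image_ideal_def)
  qed
  then show ?thesis
    unfolding image_ideal_def[of K'' h] by (intro generated_ideal_least[OF ideal]) auto
qed

text \<open>
  A frame homomorphism \<open>h\<close> carries a directed cover of \<open>y\<close> to one of \<open>h y\<close>. A member \<open>h s\<close> above
  \<open>x\<close> then transposes to a member \<open>s\<close> of the original cover above \<open>l x\<close>.
\<close>

lemma left_adjoint_way_below:
  assumes hom: "frame_hom K K' h" and adj: "adjoint_pair K' K l h"
    and y: "y \<in> carrier K" and wb: "way_below K' x (h y)"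
  shows "way_below K (l x) y"
  unfolding way_below_def
proof (intro conjI allI impI)
  note h = frame_homD[OF hom] and a = adjoint_pairD[OF adj]
  have x: "x \<in> carrier K'" using wb by (simp add: way_below_def)
  show "l x \<in> carrier K" using a(1) x by auto
  show "y \<in> carrier K" by fact
  fix S assume S: "directed_in K S" and le: "y \<sqsubseteq>\<^bsub>K\<^esub> \<Squnion>\<^bsub>K\<^esub>S"
  have SK: "S \<subseteq> carrier K" using S by (simp add: directed_in_def)
  interpret K: complete_lattice K using hom by (simp add: frame_hom_def sup_pres_def)
  have "directed_in K' (h ` S)"
    unfolding directed_in_def
  proof (intro conjI ballI)
    fix p q assume "p \<in> h ` S" "q \<in> h ` S"
    then obtain s t where st: "s \<in> S" "t \<in> S" "p = h s" "q = h t" by auto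
    then obtain r where "r \<in> S" "s \<sqsubseteq>\<^bsub>K\<^esub> r" "t \<sqsubseteq>\<^bsub>K\<^esub> r"
      using S unfolding directed_in_def by blast
    then show "\<exists>z\<in>h ` S. p \<sqsubseteq>\<^bsub>K'\<^esub> z \<and> q \<sqsubseteq>\<^bsub>K'\<^esub> z"
      using st SK use_iso2[OF h(2)] by blast
  qed (use S h(1) in \<open>auto simp: directed_in_def\<close>)
  moreover have "h y \<sqsubseteq>\<^bsub>K'\<^esub> \<Squnion>\<^bsub>K'\<^esub>(h ` S)"
    using use_iso2[OF h(2) y _ le] SK h(3) by simp
  ultimately obtain s where "s \<in> S" "x \<sqsubseteq>\<^bsub>K'\<^esub> h s"
    using wb unfolding way_below_def by blast
  then show "\<exists>s\<in>S. l x \<sqsubseteq>\<^bsub>K\<^esub> s"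
    using a(3)[OF x, of s] SK by (intro bexI[of _ s]) auto
qed

section \<open>Pushforwards and restrictions in an internal frame\<close>

context internal_frame
begin

lemma section_plain_frame: "a \<in> Obj C \<Longrightarrow> plain_frame (L a)"
  by (rule plain_frame.intro) (rule section_frame)

lemma obj_arrows:
  assumes "f \<in> arrows_into C a"
  shows "f \<in> Arr C" "Cod C f = a" "Dom C f \<in> Obj C"
  using assms Dom_Obj by (auto simp: arrows_into_def)

lemma res_closed: "\<lbrakk>f \<in> Arr C; u \<in> carrier (L (Cod C f))\<rbrakk> \<Longrightarrow> res f u \<in> carrier (L (Dom C f))"
  using frame_homD(1)[OF res_hom] by auto

lemma Sig_closed: "\<lbrakk>f \<in> Arr C; v \<in> carrier (L (Dom C f))\<rbrakk> \<Longrightarrow> Sig f v \<in> carrier (L (Cod C f))"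
  using adjoint_pairD(1)[OF Sig_adjoint] by auto

text \<open>Both sides are left adjoint to the same restriction map, so they have the same upper bounds.\<close>

lemma Sig_Comp:
  assumes f: "f \<in> Arr C" and p: "p \<in> Arr C" and fp: "Dom C f = Cod C p"
    and v: "v \<in> carrier (L (Dom C p))"
  shows "Sig f (Sig p v) = Sig (f \<cdot> p) v"
proof -
  have q: "f \<cdot> p \<in> Arr C" "Dom C (f \<cdot> p) = Dom C p" "Cod C (f \<cdot> p) = Cod C f"
    using f p fp Comp_Arr Dom_Comp Cod_Comp by auto
  interpret a: plain_frame "L (Cod C f)" using f section_plain_frame Cod_Obj by blast
  have c: "Sig p v \<in> carrier (L (Dom C f))" "Sig f (Sig p v) \<in> carrier (L (Cod C f))"
    "Sig (f \<cdot> p) v \<in> carrier (L (Cod C f))"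
    using Sig_closed[OF p v] fp Sig_closed[OF f] Sig_closed[OF q(1)] q v by auto
  have key: "Sig f (Sig p v) \<sqsubseteq>\<^bsub>L (Cod C f)\<^esub> x \<longleftrightarrow> Sig (f \<cdot> p) v \<sqsubseteq>\<^bsub>L (Cod C f)\<^esub> x"
    if x: "x \<in> carrier (L (Cod C f))" for x
  proof -
    have "Sig f (Sig p v) \<sqsubseteq>\<^bsub>L (Cod C f)\<^esub> x \<longleftrightarrow> Sig p v \<sqsubseteq>\<^bsub>L (Dom C f)\<^esub> res f x"
      using adjoint_pairD(3)[OF Sig_adjoint[OF f] c(1) x] .
    also have "\<dots> \<longleftrightarrow> v \<sqsubseteq>\<^bsub>L (Dom C p)\<^esub> res p (res f x)"
      using adjoint_pairD(3)[OF Sig_adjoint[OF p] v] res_closed[OF f x] fp by simp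
    also have "\<dots> \<longleftrightarrow> Sig (f \<cdot> p) v \<sqsubseteq>\<^bsub>L (Cod C f)\<^esub> x"
      using adjoint_pairD(3)[OF Sig_adjoint[OF q(1)]] v x q res_Comp[OF f p fp x] by simp
    finally show ?thesis .
  qed
  show ?thesis using key c by (intro a.le_antisym) auto
qed

text \<open>
  The Beck-Chevalley condition and two uses of Frobenius reciprocity turn a meet of pushforwards
  into a single pushforward from the weak pullback.
\<close>

lemma meet_Sig:
  assumes wp: "weak_pullback_square C f p g q"
    and z: "z \<in> carrier (L (Dom C f))" and t: "t \<in> carrier (L (Dom C g))"
  shows "Sig f z \<sqinter>\<^bsub>L (Cod C f)\<^esub> Sig g t =
    Sig (f \<cdot> p) (res p z \<sqinter>\<^bsub>L (Dom C p)\<^esub> res q t)"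
proof -
  have ar: "f \<in> Arr C" "g \<in> Arr C" "p \<in> Arr C" "q \<in> Arr C" "Cod C f = Cod C g"
    "Dom C p = Dom C q" "Cod C p = Dom C f" "Cod C q = Dom C g"
    and comm: "f \<cdot> p = g \<cdot> q"
    using wp by (auto simp: weak_pullback_square_def commuting_square_def)
  have Sz: "Sig f z \<in> carrier (L (Cod C g))" and pz: "res p z \<in> carrier (L (Dom C q))"
    and qt: "res q t \<in> carrier (L (Dom C q))"
    using Sig_closed[OF ar(1) z] res_closed[of p z] res_closed[of q t] ar z t by auto
  have "Sig f z \<sqinter>\<^bsub>L (Cod C f)\<^esub> Sig g t = Sig g (res g (Sig f z) \<sqinter>\<^bsub>L (Dom C g)\<^esub> t)"
    using Frobenius[OF ar(2) Sz t] ar by simp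
  also have "res g (Sig f z) = Sig q (res p z)"
    by (rule Beck_Chevalley[OF wp z])
  also have "Sig q (res p z) \<sqinter>\<^bsub>L (Dom C g)\<^esub> t = Sig q (res q t \<sqinter>\<^bsub>L (Dom C q)\<^esub> res p z)"
    using Frobenius[OF ar(4) _ pz, of t] t ar by (simp add: meet_comm)
  also have "Sig g (Sig q (res q t \<sqinter>\<^bsub>L (Dom C q)\<^esub> res p z)) =
      Sig (g \<cdot> q) (res q t \<sqinter>\<^bsub>L (Dom C q)\<^esub> res p z)"
  proof (rule Sig_Comp)
    interpret d: plain_frame "L (Dom C q)" using section_plain_frame Dom_Obj ar by blast
    show "res q t \<sqinter>\<^bsub>L (Dom C q)\<^esub> res p z \<in> carrier (L (Dom C q))" using pz qt by simp
  qed (use ar in auto)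
  finally show ?thesis using comm ar by (simp add: meet_comm)
qed

text \<open>
  An ideal \<open>J\<close> of a section extends to the internal ideal of its restrictions; this is what tests
  external covers against the internal adjunction.
\<close>

lemma restricted_ideal:
  assumes a: "a \<in> Obj C" and J: "J \<in> ideals (L a)"
  defines "I \<equiv> (\<lambda>f\<in>arrows_into C a. image_ideal (L (Dom C f)) (res f) J)"
  shows "I \<in> carrier (internal_idl C L res a)" (is ?member)
    and "I (Ident C a) = J" (is ?ident)
    and "\<Squnion>\<^bsub>L a\<^esub>J \<sqsubseteq>\<^bsub>L a\<^esub> internal_Sup C L Sig a I" (is ?Sup)
proof -
  have JK: "J \<subseteq> carrier (L a)" by (rule ideals_subset[OF J])
  interpret La: plain_frame "L a" by (rule section_plain_frame[OF a])
  show ?member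
    unfolding internal_idl_def
  proof (simp only: partial_object.simps mem_Collect_eq, intro conjI ballI impI)
    show "I \<in> (\<Pi>\<^sub>E f\<in>arrows_into C a. ideals (L (Dom C f)))"
      unfolding I_def image_ideal_def
    proof (simp only: restrict_PiE_iff, intro ballI)
      fix f assume f: "f \<in> arrows_into C a"
      show "generated_ideal (L (Dom C f)) (res f ` J) \<in> ideals (L (Dom C f))"
      proof (rule plain_frame.generated_ideal_in_ideals)
        show "plain_frame (L (Dom C f))" by (rule section_plain_frame[OF obj_arrows(3)[OF f]])
        show "res f ` J \<subseteq> carrier (L (Dom C f))"
          using res_closed[OF obj_arrows(1)[OF f]] JK obj_arrows(2)[OF f] by auto
      qed
    qed
    fix f g assume f: "f \<in> arrows_into C a" and g: "g \<in> Arr C" "Cod C g = Dom C f"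
    note fa = obj_arrows[OF f]
    have fg: "f \<cdot> g \<in> arrows_into C a" "Dom C (f \<cdot> g) = Dom C g"
      using Comp_Arr Cod_Comp Dom_Comp fa g by (auto simp: arrows_into_def)
    have "image_ideal (L (Dom C g)) (res g) (image_ideal (L (Dom C f)) (res f) J)
        \<subseteq> image_ideal (L (Dom C g)) (res g \<circ> res f) J"
    proof (rule image_ideal_image_ideal_subset[OF _ _ _ _ JK])
      show "plain_frame (L (Dom C f))" "plain_frame (L (Dom C g))"
        using section_plain_frame Dom_Obj g fa by auto
      show "frame_hom (L (Dom C f)) (L (Dom C g)) (res g)" using res_hom g by metis
      show "res f \<in> carrier (L a) \<rightarrow> carrier (L (Dom C f))" using res_closed fa by auto
    qed
    also have "image_ideal (L (Dom C g)) (res g \<circ> res f) J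
        = image_ideal (L (Dom C g)) (res (f \<cdot> g)) J"
    proof -
      have "(res g \<circ> res f) ` J = res (f \<cdot> g) ` J"
        unfolding comp_def
        using res_Comp[OF fa(1) g(1)] fa g JK by (intro image_cong) auto
      then show ?thesis by (simp add: image_ideal_def)
    qed
    finally show "image_ideal (L (Dom C g)) (res g) (I f) \<subseteq> I (f \<cdot> g)"
      using f fg by (simp add: I_def)
  qed
  have id: "Ident C a \<in> arrows_into C a" "Dom C (Ident C a) = a" "Cod C (Ident C a) = a"
    "Ident C a \<in> Arr C"
    using a Ident_Arr Cod_Ident Dom_Ident by (auto simp: arrows_into_def)
  have "res (Ident C a) ` J = (\<lambda>x. x) ` J"
    using res_Ident[OF a] JK by (intro image_cong) auto
  then have "res (Ident C a) ` J = J" by simp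
  then show ident: ?ident
    using id generated_ideal_ideal[OF J] by (simp add: I_def image_ideal_def)
  let ?X = "\<Union>f\<in>arrows_into C a. image_ideal (L a) (Sig f) (I f)"
  have XK: "?X \<subseteq> carrier (L a)"
  proof (rule UN_least)
    fix f assume f: "f \<in> arrows_into C a"
    note fa = obj_arrows[OF f]
    have "I f \<in> ideals (L (Dom C f))"
      using \<open>?member\<close> f by (auto simp: internal_idl_def)
    then have "Sig f ` I f \<subseteq> carrier (L a)"
      using Sig_closed[OF fa(1)] fa(2) by (auto dest: subsetD[OF ideals_subset])
    then show "image_ideal (L a) (Sig f) (I f) \<subseteq> carrier (L a)"
      unfolding image_ideal_def by (rule generated_ideal_least[OF La.carrier_ideal])
  qed
  show ?Sup
    unfolding internal_Sup_def
  proof (rule La.sup_least[OF JK La.sup_closed[OF XK]])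
    fix j assume j: "j \<in> J"
    then have jK: "j \<in> carrier (L a)" using JK by auto
    have Sj: "Sig (Ident C a) j \<in> carrier (L a)"
      using Sig_closed[OF id(4)] jK id by simp
    have "j \<sqsubseteq>\<^bsub>L a\<^esub> res (Ident C a) (Sig (Ident C a) j)"
      using adjoint_pairD(3)[OF Sig_adjoint[OF id(4)], of j "Sig (Ident C a) j"] jK Sj id by simp
    then have le: "j \<sqsubseteq>\<^bsub>L a\<^esub> Sig (Ident C a) j"
      using res_Ident[OF a Sj] by simp
    have "Sig (Ident C a) j \<in> image_ideal (L a) (Sig (Ident C a)) (I (Ident C a))"
      unfolding image_ideal_def ident by (rule generated_ideal_incl[OF imageI[OF j]])
    then have "Sig (Ident C a) j \<sqsubseteq>\<^bsub>L a\<^esub> \<Squnion>\<^bsub>L a\<^esub>?X"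
      using id(1) by (intro La.sup_upper[OF XK]) auto
    then show "j \<sqsubseteq>\<^bsub>L a\<^esub> \<Squnion>\<^bsub>L a\<^esub>?X"
      using La.le_trans[OF le _ jK Sj La.sup_closed[OF XK]] by simp
  qed
qed

section \<open>Stable local compactness of the sections\<close>

context
  fixes Lam
  assumes adj: "left_adjoint_to_internal_Sup C L res Sig Lam"
begin

lemma Lam_adjoint:
  "a \<in> Obj C \<Longrightarrow> adjoint_pair (L a) (internal_idl C L res a) (Lam a) (internal_Sup C L Sig a)"
  using adj by (simp add: left_adjoint_to_internal_Sup_def)

lemma Lam_closed:
  assumes "a \<in> Obj C" "u \<in> carrier (L a)"
  shows "Lam a u \<in> carrier (internal_idl C L res a)"
  using funcset_mem[OF adjoint_pairD(1)[OF Lam_adjoint[OF assms(1)]] assms(2)] .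

lemma Lam_component_ideal:
  assumes "u \<in> carrier (L a)" "f \<in> arrows_into C a"
  shows "Lam a u f \<in> ideals (L (Dom C f))"
proof -
  have "a \<in> Obj C" using Cod_Obj assms(2) by (auto simp: arrows_into_def)
  then show ?thesis
    using Lam_closed[of a u] assms by (auto simp: internal_idl_def)
qed

text \<open>
  Naturality along \<open>f\<close>, read at the identity arrow, determines all of \<open>Lam\<close> by its identity
  components.
\<close>

lemma Lam_natural:
  assumes f: "f \<in> arrows_into C a" and u: "u \<in> carrier (L a)"
  shows "Lam (Dom C f) (res f u) (Ident C (Dom C f)) = Lam a u f"
proof -
  note fa = obj_arrows[OF f]
  have "Lam (Dom C f) (res f u) = internal_idl_res C f (Lam a u)"
    using adj fa u by (auto simp: left_adjoint_to_internal_Sup_def)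
  moreover have "Ident C (Dom C f) \<in> arrows_into C (Dom C f)"
    using fa Ident_Arr Cod_Ident by (auto simp: arrows_into_def)
  ultimately show ?thesis
    using Comp_Ident[OF fa(1)] by (simp add: internal_idl_res_def)
qed

text \<open>
  An ideal \<open>J\<close> covering \<open>u\<close> restricts to an internal ideal covering \<open>u\<close>, which therefore
  contains \<open>Lam a u\<close>; at the identity arrow this internal ideal is \<open>J\<close> itself.
\<close>

lemma Lam_Ident_way_below:
  assumes a: "a \<in> Obj C" and u: "u \<in> carrier (L a)" and y: "y \<in> Lam a u (Ident C a)"
  shows "way_below (L a) y u"
proof -
  interpret La: plain_frame "L a" by (rule section_plain_frame[OF a])
  have id: "Ident C a \<in> arrows_into C a" "Dom C (Ident C a) = a"
    using a Ident_Arr Cod_Ident Dom_Ident by (auto simp: arrows_into_def)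
  show ?thesis
  proof (rule La.way_belowI_ideal[OF _ u])
    show "y \<in> carrier (L a)"
      using subsetD[OF ideals_subset[OF Lam_component_ideal[OF u id(1)]] y] id(2) by simp
    fix J assume J: "J \<in> ideals (L a)" and le: "u \<sqsubseteq>\<^bsub>L a\<^esub> \<Squnion>\<^bsub>L a\<^esub>J"
    let ?I = "\<lambda>f\<in>arrows_into C a. image_ideal (L (Dom C f)) (res f) J"
    note I = restricted_ideal[OF a J]
    have "u \<sqsubseteq>\<^bsub>L a\<^esub> internal_Sup C L Sig a ?I"
      using La.le_trans[OF le I(3) u La.sup_closed[OF ideals_subset[OF J]]]
        funcset_mem[OF adjoint_pairD(2)[OF Lam_adjoint[OF a]] I(1)] by simp
    then have "Lam a u \<sqsubseteq>\<^bsub>internal_idl C L res a\<^esub> ?I"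
      using adjoint_pairD(3)[OF Lam_adjoint[OF a] u I(1)] by simp
    then have "Lam a u (Ident C a) \<subseteq> ?I (Ident C a)"
      using id(1) unfolding internal_idl_def by simp
    then show "y \<in> J" using y I(2) by auto
  qed
qed

lemma Lam_way_below:
  assumes f: "f \<in> arrows_into C a" and u: "u \<in> carrier (L a)" and y: "y \<in> Lam a u f"
  shows "way_below (L (Dom C f)) y (res f u)"
proof (rule Lam_Ident_way_below)
  note fa = obj_arrows[OF f]
  show "Dom C f \<in> Obj C" by (rule fa)
  show "res f u \<in> carrier (L (Dom C f))" using res_closed[OF fa(1)] fa(2) u by simp
  show "y \<in> Lam (Dom C f) (res f u) (Ident C (Dom C f))" using y Lam_natural[OF f u] by simp
qed

text \<open>
  The generators whose supremum is the internal supremum of \<open>Lam a u\<close>. They are the link between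
  the internal approximation of \<open>u\<close> and the way-below relation of \<open>L a\<close>.
\<close>

definition pushed :: "'o \<Rightarrow> 'x \<Rightarrow> 'x set" where
  "pushed a u = (\<Union>f\<in>arrows_into C a. Sig f ` Lam a u f)"

lemma pushed_way_below:
  assumes u: "u \<in> carrier (L a)" and x: "x \<in> pushed a u"
  shows "way_below (L a) x u"
proof -
  obtain f z where f: "f \<in> arrows_into C a" and z: "z \<in> Lam a u f" "x = Sig f z"
    using x by (auto simp: pushed_def)
  note fa = obj_arrows[OF f]
  show ?thesis
    using left_adjoint_way_below[OF res_hom[OF fa(1)] Sig_adjoint[OF fa(1)]]
      Lam_way_below[OF f u z(1)] u z fa by simp
qed

lemma pushed_closed: "u \<in> carrier (L a) \<Longrightarrow> pushed a u \<subseteq> carrier (L a)"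
  using pushed_way_below by (auto simp: way_below_def)

lemma le_Sup_pushed:
  assumes a: "a \<in> Obj C" and u: "u \<in> carrier (L a)"
  shows "u \<sqsubseteq>\<^bsub>L a\<^esub> \<Squnion>\<^bsub>L a\<^esub>(pushed a u)"
proof -
  interpret La: plain_frame "L a" by (rule section_plain_frame[OF a])
  let ?G = "\<Union>f\<in>arrows_into C a. image_ideal (L a) (Sig f) (Lam a u f)"
  have c: "\<Squnion>\<^bsub>L a\<^esub>(pushed a u) \<in> carrier (L a)"
    using pushed_closed[OF u] by (rule La.sup_closed)
  have G: "?G \<subseteq> {x \<in> carrier (L a). x \<sqsubseteq>\<^bsub>L a\<^esub> \<Squnion>\<^bsub>L a\<^esub>(pushed a u)}"
    unfolding image_ideal_def
  proof (intro UN_least generated_ideal_least[OF La.principal_ideal[OF c]])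
    fix f assume "f \<in> arrows_into C a"
    then have "Sig f ` Lam a u f \<subseteq> pushed a u" by (auto simp: pushed_def)
    then show "Sig f ` Lam a u f \<subseteq> {x \<in> carrier (L a). x \<sqsubseteq>\<^bsub>L a\<^esub> \<Squnion>\<^bsub>L a\<^esub>(pushed a u)}"
      using pushed_closed[OF u] La.sup_upper by blast
  qed
  then have GK: "?G \<subseteq> carrier (L a)" by blast
  have "u \<sqsubseteq>\<^bsub>L a\<^esub> internal_Sup C L Sig a (Lam a u)"
    using galois_connection.inflation[OF Lam_adjoint[OF a]] u by simp
  then have "u \<sqsubseteq>\<^bsub>L a\<^esub> \<Squnion>\<^bsub>L a\<^esub>?G" by (simp add: internal_Sup_def)
  moreover have "\<Squnion>\<^bsub>L a\<^esub>?G \<sqsubseteq>\<^bsub>L a\<^esub> \<Squnion>\<^bsub>L a\<^esub>(pushed a u)"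
    using G by (intro La.sup_least[OF GK c]) blast
  ultimately show ?thesis using La.le_trans[OF _ _ u La.sup_closed[OF GK] c] by simp
qed

lemma section_locally_compact:
  assumes a: "a \<in> Obj C"
  shows "locally_compact_frame (L a)"
  unfolding locally_compact_frame_def
proof (intro conjI ballI)
  show "frame (L a)" by (rule section_frame[OF a])
  interpret La: plain_frame "L a" by (rule section_plain_frame[OF a])
  fix u assume u: "u \<in> carrier (L a)"
  let ?W = "{y. way_below (L a) y u}"
  have W: "?W \<subseteq> carrier (L a)" by (auto simp: way_below_def)
  have "\<Squnion>\<^bsub>L a\<^esub>(pushed a u) \<sqsubseteq>\<^bsub>L a\<^esub> \<Squnion>\<^bsub>L a\<^esub>?W"
    using pushed_closed[OF u] W pushed_way_below[OF u]
    by (intro La.sup_least La.sup_closed La.sup_upper) auto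
  then have "u \<sqsubseteq>\<^bsub>L a\<^esub> \<Squnion>\<^bsub>L a\<^esub>?W"
    using La.le_trans[OF le_Sup_pushed[OF a u] _ u La.sup_closed[OF pushed_closed[OF u]]
        La.sup_closed[OF W]] by simp
  moreover have "\<Squnion>\<^bsub>L a\<^esub>?W \<sqsubseteq>\<^bsub>L a\<^esub> u"
    using W u La.way_below_imp_le by (intro La.sup_least) auto
  ultimately show "u = \<Squnion>\<^bsub>L a\<^esub>?W"
    using u W La.sup_closed by (intro La.le_antisym) auto
qed

text \<open>
  A weak pullback of \<open>f\<close> and \<open>g\<close> rewrites the meet of two pushforwards as one pushforward of a
  meet, formed at a common arrow, where stability of \<open>Lam\<close> applies.
\<close>

lemma meet_pushed:
  assumes wpb: "has_weak_pullbacks C"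
    and stable: "\<And>b v w. \<lbrakk>b \<in> Obj C; v \<in> carrier (L b); w \<in> carrier (L b)\<rbrakk> \<Longrightarrow>
      Lam b (v \<sqinter>\<^bsub>L b\<^esub> w) = (\<lambda>f\<in>arrows_into C b. Lam b v f \<inter> Lam b w f)"
    and a: "a \<in> Obj C" and u: "u \<in> carrier (L a)" and w: "w \<in> carrier (L a)"
    and x: "x \<in> pushed a u" and y: "y \<in> pushed a w"
  shows "x \<sqinter>\<^bsub>L a\<^esub> y \<in> pushed a (u \<sqinter>\<^bsub>L a\<^esub> w)"
proof -
  obtain f z where f: "f \<in> arrows_into C a" and z: "z \<in> Lam a u f" and xz: "x = Sig f z"
    using x by (auto simp: pushed_def)
  obtain g t where g: "g \<in> arrows_into C a" and t: "t \<in> Lam a w g" and yt: "y = Sig g t"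
    using y by (auto simp: pushed_def)
  note fa = obj_arrows[OF f] and ga = obj_arrows[OF g]
  obtain p q where wp: "weak_pullback_square C f p g q"
    using wpb fa ga unfolding has_weak_pullbacks_def by metis
  then have ar: "p \<in> Arr C" "q \<in> Arr C" "Dom C p = Dom C q" "Cod C p = Dom C f"
    "Cod C q = Dom C g" and comm: "f \<cdot> p = g \<cdot> q"
    by (auto simp: weak_pullback_square_def commuting_square_def)
  have k: "f \<cdot> p \<in> arrows_into C a" "Dom C (f \<cdot> p) = Dom C p"
    using Comp_Arr Cod_Comp Dom_Comp fa ar by (auto simp: arrows_into_def)
  have zt: "z \<in> carrier (L (Dom C f))" "t \<in> carrier (L (Dom C g))"
    using subsetD[OF ideals_subset[OF Lam_component_ideal[OF u f]] z]
      subsetD[OF ideals_subset[OF Lam_component_ideal[OF w g]] t] .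
  \<comment> \<open>Membership in a component of \<open>Lam a v\<close> is stable under further restriction.\<close>
  have restrict: "res r c \<in> Lam a v (h \<cdot> r)"
    if "h \<in> arrows_into C a" "r \<in> Arr C" "Cod C r = Dom C h" "v \<in> carrier (L a)" "c \<in> Lam a v h"
    for h r v c
  proof -
    have "image_ideal (L (Dom C r)) (res r) (Lam a v h) \<subseteq> Lam a v (h \<cdot> r)"
      using Lam_closed[OF a that(4)] that by (simp add: internal_idl_def)
    then show ?thesis
      unfolding image_ideal_def using generated_ideal_incl[OF imageI[OF that(5)]] by (rule subsetD)
  qed
  interpret d: plain_frame "L (Dom C p)" using section_plain_frame Dom_Obj ar by blast
  have pz: "res p z \<in> Lam a u (f \<cdot> p)" and qt: "res q t \<in> Lam a w (f \<cdot> p)"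
    using restrict[OF f ar(1,4) u z] restrict[OF g ar(2,5) w t] comm by auto
  have car: "res p z \<in> carrier (L (Dom C p))" "res q t \<in> carrier (L (Dom C p))"
    using res_closed[OF ar(1)] res_closed[OF ar(2)] zt ar by auto
  have "res p z \<sqinter>\<^bsub>L (Dom C p)\<^esub> res q t \<in> Lam a u (f \<cdot> p)"
    "res p z \<sqinter>\<^bsub>L (Dom C p)\<^esub> res q t \<in> Lam a w (f \<cdot> p)"
    using ideals_down[OF Lam_component_ideal[OF u k(1)] pz]
      ideals_down[OF Lam_component_ideal[OF w k(1)] qt] k(2) car d.meet_left d.meet_right by auto
  then have "res p z \<sqinter>\<^bsub>L (Dom C p)\<^esub> res q t \<in> Lam a (u \<sqinter>\<^bsub>L a\<^esub> w) (f \<cdot> p)"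
    using stable[OF a u w] k by simp
  then have "Sig (f \<cdot> p) (res p z \<sqinter>\<^bsub>L (Dom C p)\<^esub> res q t) \<in> pushed a (u \<sqinter>\<^bsub>L a\<^esub> w)"
    using k by (auto simp: pushed_def)
  then show ?thesis
    using meet_Sig[OF wp zt] xz yt fa by simp
qed

text \<open>
  If \<open>y\<close> is way below both \<open>u\<close> and \<open>w\<close>, it lies in the ideals generated by the respective
  pushforwards. Meets of these generators are way below \<open>u \<sqinter> w\<close>, hence so is \<open>y = y \<sqinter> y\<close>.
\<close>

lemma section_stably_locally_compact:
  assumes wpb: "has_weak_pullbacks C"
    and stable: "\<And>b v w. \<lbrakk>b \<in> Obj C; v \<in> carrier (L b); w \<in> carrier (L b)\<rbrakk> \<Longrightarrow>
      Lam b (v \<sqinter>\<^bsub>L b\<^esub> w) = (\<lambda>f\<in>arrows_into C b. Lam b v f \<inter> Lam b w f)"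
    and a: "a \<in> Obj C"
  shows "stably_locally_compact_frame (L a)"
  unfolding stably_locally_compact_frame_def
proof (intro conjI ballI equalityI subsetI)
  show "locally_compact_frame (L a)" by (rule section_locally_compact[OF a])
  interpret La: plain_frame "L a" by (rule section_plain_frame[OF a])
  fix u w y assume u: "u \<in> carrier (L a)" and w: "w \<in> carrier (L a)"
  have uw: "u \<sqinter>\<^bsub>L a\<^esub> w \<in> carrier (L a)" using u w by simp
  show "y \<in> {y. way_below (L a) y u} \<inter> {y. way_below (L a) y w}"
    if "y \<in> {y. way_below (L a) y (u \<sqinter>\<^bsub>L a\<^esub> w)}"
    using La.way_below_mono[OF _ u La.meet_left[OF u w]]
      La.way_below_mono[OF _ w La.meet_right[OF u w]] that by simp
  assume "y \<in> {y. way_below (L a) y u} \<inter> {y. way_below (L a) y w}"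
  then have y: "way_below (L a) y u" "way_below (L a) y w" by auto
  have "y \<sqinter>\<^bsub>L a\<^esub> y \<in> {y. way_below (L a) y (u \<sqinter>\<^bsub>L a\<^esub> w)}"
  proof (rule La.meet_generated_ideals[OF La.way_below_ideal[OF uw]
        pushed_closed[OF u] pushed_closed[OF w]])
    show "y \<in> generated_ideal (L a) (pushed a u)" "y \<in> generated_ideal (L a) (pushed a w)"
      using La.way_below_Sup_generated[OF y(1) pushed_closed[OF u] le_Sup_pushed[OF a u]]
        La.way_below_Sup_generated[OF y(2) pushed_closed[OF w] le_Sup_pushed[OF a w]] by simp_all
    show "s \<sqinter>\<^bsub>L a\<^esub> t \<in> {y. way_below (L a) y (u \<sqinter>\<^bsub>L a\<^esub> w)}"
      if "s \<in> pushed a u" "t \<in> pushed a w" for s t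
      using meet_pushed[OF wpb stable a u w that] pushed_way_below[OF uw] by simp
  qed
  moreover have "y \<sqinter>\<^bsub>L a\<^esub> y = y"
    using y(1) La.le_iff_join[of y y] by (auto simp: way_below_def)
  ultimately show "y \<in> {y. way_below (L a) y (u \<sqinter>\<^bsub>L a\<^esub> w)}" by simp
qed

end

end

theorem proposition3p8:
  fixes C :: "('o, 'm) cat"
    and L :: "'o \<Rightarrow> 'x gorder"
    and res Sig :: "'m \<Rightarrow> 'x \<Rightarrow> 'x"
  assumes "category C"
    and "has_weak_pullbacks C"
    and "internal_frame C L res Sig"
    and "internally_stably_locally_compact C L res Sig"
  shows "\<forall>a\<in>Obj C. stably_locally_compact_frame (L a)"
proof
  fix a assume a: "a \<in> Obj C"
  obtain Lam where Lam: "left_adjoint_to_internal_Sup C L res Sig Lam"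
    and stable: "\<And>b v w. \<lbrakk>b \<in> Obj C; v \<in> carrier (L b); w \<in> carrier (L b)\<rbrakk> \<Longrightarrow>
      Lam b (v \<sqinter>\<^bsub>L b\<^esub> w) = (\<lambda>f\<in>arrows_into C b. Lam b v f \<inter> Lam b w f)"
    using assms(4) unfolding internally_stably_locally_compact_def by blast
  show "stably_locally_compact_frame (L a)"
    by (rule internal_frame.section_stably_locally_compact[OF assms(3) Lam assms(2) stable a])
qed

end
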